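(* Let $N\ge 1$ and let decision making units $1,\dots,N$ be given with nonnegative input vectors $a_1,\dots,a_N\in\mathbb{R}^{n_1}$ and nonnegative output vectors $b_1,\dots,b_N\in\mathbb{R}^{n_2}$. Let $c_k$ be the classical DEA ranking and $r_k$ the robust linear programming ranking of unit $k$, both defined in the context. Then the list of units sorted by $r$ is the same as the list sorted by $c$; that is, for all $k,l\in\{1,\dots,N\}$, $r_k\le r_l$ if and only if $c_k\le c_l$.
   Context: For each $k\in\{1,\dots,N\}$ take unit $k$ as the tested unit $\mathrm{DMU}_0$: put $x_0=a_k$, $y_0=b_k$, and let $X$ and $Y$ be the matrices whose rows are $a_i^T$ and $b_i^T$, respectively, for $i\ne k$. Vector inequalities are entrywise. The classical DEA (CCR) ranking $c_k\in[0,+\infty]$ of unit $k$ is the optimal value of $$\max\ y_0^Tu\quad\text{subject to}\quad x_0^Tv\le 1,\ Yu-Xv\le 0,\ u,v\ge 0$$ (with value $+\infty$ if the program is unbounded). The robust linear programming ranking of unit $k$ is $r_k=1+\delta^*$, where $\delta^*$ is the optimal value of $$\max\ \delta\quad\text{subject to}\quad y_0^T\tilde u\ge 1+\delta,\ \ x_0^T\tilde v\le 1-\delta,\ \ Y\tilde u-X\tilde v\le 0,\ \ \tilde u,\tilde v\ge 0$$ in the variables $\delta\in\mathbb{R}$, $\tilde u\in\mathbb{R}^{n_2}$, $\tilde v\in\mathbb{R}^{n_1}$. *)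

theory Defs
  imports "HOL-Analysis.Analysis"
begin

text \<open>
  Unit \<open>i\<close> has input vector \<open>a i\<close> and output vector \<open>b i\<close>, for \<open>i \<in> {1..N}\<close>.
  The order on \<open>real ^ 'n\<close> is the entrywise one (\<open>less_eq_vec_def\<close>).
\<close>

text \<open>
  The optimal value is taken in the extended reals: \<open>\<infinity>\<close> for an unbounded program,
  \<open>-\<infinity>\<close> for an infeasible one.
\<close>

definition lp_max_value :: "'s set \<Rightarrow> ('s \<Rightarrow> real) \<Rightarrow> ereal" where
  "lp_max_value S f = (SUP s\<in>S. ereal (f s))"

text \<open>
  \<open>Y u - X v \<le> 0\<close>, written row by row; the rows of \<open>X\<close> and \<open>Y\<close> are the vectors \<open>a i\<close>
  and \<open>b i\<close> of all units other than the tested unit \<open>k\<close>.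
\<close>

definition other_units_le ::
  "nat \<Rightarrow> (nat \<Rightarrow> real ^ 'n) \<Rightarrow> (nat \<Rightarrow> real ^ 'm) \<Rightarrow> nat \<Rightarrow> real ^ 'm \<Rightarrow> real ^ 'n \<Rightarrow> bool" where
  "other_units_le N a b k u v \<longleftrightarrow> (\<forall>i\<in>{1..N} - {k}. b i \<bullet> u - a i \<bullet> v \<le> 0)"

definition dea_feasible ::
  "nat \<Rightarrow> (nat \<Rightarrow> real ^ 'n) \<Rightarrow> (nat \<Rightarrow> real ^ 'm) \<Rightarrow> nat \<Rightarrow> ((real ^ 'm) \<times> (real ^ 'n)) set" where
  "dea_feasible N a b k =
     {(u, v). a k \<bullet> v \<le> 1 \<and> other_units_le N a b k u v \<and> 0 \<le> u \<and> 0 \<le> v}"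

definition dea_ranking ::
  "nat \<Rightarrow> (nat \<Rightarrow> real ^ 'n) \<Rightarrow> (nat \<Rightarrow> real ^ 'm) \<Rightarrow> nat \<Rightarrow> ereal" where
  "dea_ranking N a b k = lp_max_value (dea_feasible N a b k) (\<lambda>(u, v). b k \<bullet> u)"

definition robust_feasible ::
  "nat \<Rightarrow> (nat \<Rightarrow> real ^ 'n) \<Rightarrow> (nat \<Rightarrow> real ^ 'm) \<Rightarrow> nat \<Rightarrow> (real \<times> (real ^ 'm) \<times> (real ^ 'n)) set" where
  "robust_feasible N a b k =
     {(\<delta>, u, v). b k \<bullet> u \<ge> 1 + \<delta> \<and> a k \<bullet> v \<le> 1 - \<delta> \<and>
                 other_units_le N a b k u v \<and> 0 \<le> u \<and> 0 \<le> v}"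

definition robust_ranking ::
  "nat \<Rightarrow> (nat \<Rightarrow> real ^ 'n) \<Rightarrow> (nat \<Rightarrow> real ^ 'm) \<Rightarrow> nat \<Rightarrow> ereal" where
  "robust_ranking N a b k = 1 + lp_max_value (robust_feasible N a b k) (\<lambda>(\<delta>, u, v). \<delta>)"

end

theory Submission
  imports Defs
begin

text \<open>
  Both programs are homogeneous up to normalization: the constraints \<open>Y u - X v \<le> 0\<close>,
  \<open>u \<ge> 0\<close>, \<open>v \<ge> 0\<close> cut out one and the same cone, and on this cone both
  optimal values measure how large the ratio of output \<open>b k \<bullet> u\<close> to input
  \<open>a k \<bullet> v\<close> can be.  The classical program bounds the input by 1 and reads off the ratio
  as the output \<open>t\<close>; the robust one bounds the output below by \<open>1 + \<delta>\<close> and the input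
  above by \<open>1 - \<delta>\<close>.  When these bounds are tight, \<open>t = (1 + \<delta>) / (1 - \<delta>)\<close>, that is \<open>\<delta> = (t - 1) / (t + 1) = 1 - 2 / (1 + t)\<close>.
  This map is strictly increasing from \<open>[0, \<infinity>)\<close> onto \<open>[-1, 1)\<close>.  In terms of the
  rankings, \<open>r = 2 c / (1 + c)\<close>, with \<open>r = 2\<close> when \<open>c = \<infinity>\<close>.

  The optima need not be attained (the classical one may even be infinite), so the
  correspondence is established between strict lower bounds: \<open>t < c\<close> holds exactly when
  \<open>1 - 2 / (1 + t) < \<delta>*\<close> (\<open>dea_ranking_gt_iff\<close>).  Since \<open>0 \<le> c\<close> and
  \<open>-1 \<le> \<delta>* \<le> 1\<close>, the thresholds \<open>t \<ge> 0\<close> on one side and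
  \<open>s \<in> [-1, 1)\<close> on the other separate any two distinct optimal values, and the two orders
  agree.
\<close>

text \<open>The margin \<open>\<delta>\<close> at which the robust normalization realizes the output to input ratio \<open>t\<close>.\<close>

definition margin :: "real \<Rightarrow> real" where
  "margin t = 1 - 2 / (1 + t)"

definition robust_value ::
  "nat \<Rightarrow> (nat \<Rightarrow> real ^ 'n) \<Rightarrow> (nat \<Rightarrow> real ^ 'm) \<Rightarrow> nat \<Rightarrow> ereal" where
  "robust_value N a b k = lp_max_value (robust_feasible N a b k) (\<lambda>(\<delta>, u, v). \<delta>)"

lemma margin_less_1: "0 \<le> t \<Longrightarrow> margin t < 1"
  by (simp add: margin_def)

lemma margin_strict_mono: "0 \<le> t \<Longrightarrow> t < t' \<Longrightarrow> margin t < margin t'"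
  by (simp add: margin_def divide_strict_left_mono)

lemma less_margin_inverse:
  assumes "0 \<le> t" "\<delta> < 1" "margin t < \<delta>"
  shows "t < (1 + \<delta>) / (1 - \<delta>)"
  using assms by (simp add: margin_def field_simps)

lemma margin_surj:
  assumes "-1 \<le> s" "s < 1"
  obtains t where "0 \<le> t" "margin t = s"
proof
  show "0 \<le> (1 + s) / (1 - s)" using assms by simp
  have "1 + (1 + s) / (1 - s) = 2 / (1 - s)" using assms by (simp add: field_simps)
  then show "margin ((1 + s) / (1 - s)) = s"
    by (simp add: margin_def diff_divide_distrib)
qed

lemma inner_vec_nonneg:
  fixes x y :: "real ^ 'n"
  assumes "0 \<le> x" "0 \<le> y"
  shows "0 \<le> x \<bullet> y"
  using assms by (auto simp: inner_vec_def less_eq_vec_def intro!: sum_nonneg)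

lemma scaleR_vec_nonneg:
  fixes x :: "real ^ 'n"
  assumes "0 \<le> c" "0 \<le> x"
  shows "0 \<le> c *\<^sub>R x"
  using assms by (auto simp: less_eq_vec_def)

lemma other_units_le_scaleR:
  assumes "other_units_le N a b k u v" "0 \<le> c"
  shows "other_units_le N a b k (c *\<^sub>R u) (c *\<^sub>R v)"
  using assms
  by (auto simp: other_units_le_def mult_left_mono)

text \<open>The factor \<open>2 / (1 + t)\<close> is the one that makes the output \<open>t\<close> and the input bound 1
  add up to 2, as the two robust bounds \<open>1 + \<delta>\<close> and \<open>1 - \<delta>\<close> do.\<close>

lemma dea_feasible_imp_robust_feasible:
  assumes "(u, v) \<in> dea_feasible N a b k" and t: "t = b k \<bullet> u" "0 \<le> t"
  shows "(margin t, (2 / (1 + t)) *\<^sub>R u, (2 / (1 + t)) *\<^sub>R v) \<in> robust_feasible N a b k"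
proof -
  have "2 / (1 + t) * (a k \<bullet> v) \<le> 2 / (1 + t) * 1"
    using assms by (intro mult_left_mono) (auto simp: dea_feasible_def)
  moreover have "2 / (1 + t) * (b k \<bullet> u) = 1 + margin t"
    using t by (simp add: margin_def field_simps)
  ultimately show ?thesis
    using assms unfolding dea_feasible_def robust_feasible_def
    by (auto simp: margin_def intro!: other_units_le_scaleR scaleR_vec_nonneg)
qed

text \<open>Dividing by the input bound \<open>1 - \<delta>\<close> goes back; the value obtained is only bounded
  below, since the output constraint of the robust program is an inequality.\<close>

lemma robust_feasible_imp_dea_feasible:
  assumes "(\<delta>, u, v) \<in> robust_feasible N a b k" "\<delta> < 1"
  shows "((1 / (1 - \<delta>)) *\<^sub>R u, (1 / (1 - \<delta>)) *\<^sub>R v) \<in> dea_feasible N a b k"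
    and "(1 + \<delta>) / (1 - \<delta>) \<le> b k \<bullet> ((1 / (1 - \<delta>)) *\<^sub>R u)"
proof -
  show "((1 / (1 - \<delta>)) *\<^sub>R u, (1 / (1 - \<delta>)) *\<^sub>R v) \<in> dea_feasible N a b k"
    using assms unfolding dea_feasible_def robust_feasible_def
    by (auto intro!: other_units_le_scaleR scaleR_vec_nonneg)
  show "(1 + \<delta>) / (1 - \<delta>) \<le> b k \<bullet> ((1 / (1 - \<delta>)) *\<^sub>R u)"
    using assms by (auto simp: robust_feasible_def divide_right_mono)
qed

lemma robust_feasible_antimono:
  assumes "(\<delta>, u, v) \<in> robust_feasible N a b k" "\<delta>' \<le> \<delta>"
  shows "(\<delta>', u, v) \<in> robust_feasible N a b k"
  using assms by (auto simp: robust_feasible_def)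

lemma dea_ranking_gt_iff:
  assumes "0 \<le> t"
  shows "ereal t < dea_ranking N a b k \<longleftrightarrow> ereal (margin t) < robust_value N a b k"
proof
  assume "ereal t < dea_ranking N a b k"
  then obtain u v where uv: "(u, v) \<in> dea_feasible N a b k" "t < b k \<bullet> u"
    by (auto simp: dea_ranking_def lp_max_value_def less_SUP_iff)
  then have "margin t < margin (b k \<bullet> u)"
    using assms margin_strict_mono by blast
  moreover note dea_feasible_imp_robust_feasible[OF uv(1) refl]
  ultimately show "ereal (margin t) < robust_value N a b k"
    using assms uv(2) unfolding robust_value_def lp_max_value_def less_SUP_iff
    by (intro bexI) auto
next
  assume "ereal (margin t) < robust_value N a b k"
  then obtain \<delta> u v where feas: "(\<delta>, u, v) \<in> robust_feasible N a b k" "margin t < \<delta>"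
    by (auto simp: robust_value_def lp_max_value_def less_SUP_iff)
  \<comment> \<open>\<open>\<delta> = 1\<close> is feasible when some weights give the unit positive output at zero input.
    Lowering the margin below 1 keeps the point feasible and makes it rescalable.\<close>
  obtain \<delta>' where \<delta>': "margin t < \<delta>'" "\<delta>' < min \<delta> 1"
    using dense[of "margin t" "min \<delta> 1"] feas(2) margin_less_1[OF assms] by auto
  have "(\<delta>', u, v) \<in> robust_feasible N a b k"
    using robust_feasible_antimono[OF feas(1)] \<delta>' by simp
  note dea = robust_feasible_imp_dea_feasible[OF this]
  have "t < (1 + \<delta>') / (1 - \<delta>')"
    using less_margin_inverse assms \<delta>' by simp
  also have "\<dots> \<le> b k \<bullet> ((1 / (1 - \<delta>')) *\<^sub>R u)"
    using dea(2) \<delta>' by simp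
  finally show "ereal t < dea_ranking N a b k"
    using dea(1) \<delta>' unfolding dea_ranking_def lp_max_value_def less_SUP_iff
    by (intro bexI) auto
qed

lemma dea_ranking_nonneg:
  "0 \<le> dea_ranking N a b k"
proof -
  have "(0, 0) \<in> dea_feasible N a b k"
    by (simp add: dea_feasible_def other_units_le_def)
  then show ?thesis
    unfolding dea_ranking_def lp_max_value_def by (rule SUP_upper2) simp
qed

lemma robust_value_ge: "-1 \<le> robust_value N a b k"
proof -
  have "(-1, 0, 0) \<in> robust_feasible N a b k"
    by (simp add: robust_feasible_def other_units_le_def)
  then show ?thesis
    unfolding robust_value_def lp_max_value_def
    by (rule SUP_upper2) (simp add: one_ereal_def)
qed

text \<open>A margin above 1 would force the input \<open>a k \<bullet> v\<close> to be negative.\<close>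

lemma robust_value_le:
  assumes "0 \<le> a k"
  shows "robust_value N a b k \<le> 1"
  unfolding robust_value_def lp_max_value_def
proof (rule SUP_least, clarsimp)
  fix \<delta> u v assume "(\<delta>, u, v) \<in> robust_feasible N a b k"
  then have "0 \<le> v" "a k \<bullet> v \<le> 1 - \<delta>" by (auto simp: robust_feasible_def)
  with inner_vec_nonneg[OF assms] show "\<delta> \<le> 1" by fastforce
qed

lemma robust_value_le_iff_dea_ranking_le:
  assumes "0 \<le> a k"
  shows "robust_value N a b k \<le> robust_value N a b l \<longleftrightarrow>
         dea_ranking N a b k \<le> dea_ranking N a b l"
proof
  assume le: "robust_value N a b k \<le> robust_value N a b l"
  show "dea_ranking N a b k \<le> dea_ranking N a b l"
  proof (rule ccontr)
    assume "\<not> dea_ranking N a b k \<le> dea_ranking N a b l"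
    then obtain t where t: "dea_ranking N a b l < ereal t" "ereal t < dea_ranking N a b k"
      using ereal_dense2[of "dea_ranking N a b l" "dea_ranking N a b k"] by (auto simp: not_le)
    have "0 < ereal t"
      using dea_ranking_nonneg t(1) by (rule le_less_trans)
    then have "0 \<le> t" by simp
    have "ereal (margin t) < robust_value N a b k"
      using t(2) \<open>0 \<le> t\<close> by (simp add: dea_ranking_gt_iff)
    also note le
    finally have "ereal t < dea_ranking N a b l"
      using \<open>0 \<le> t\<close> by (simp add: dea_ranking_gt_iff)
    with t(1) show False by simp
  qed
next
  assume le: "dea_ranking N a b k \<le> dea_ranking N a b l"
  show "robust_value N a b k \<le> robust_value N a b l"
  proof (rule ccontr)
    assume "\<not> robust_value N a b k \<le> robust_value N a b l"
    then obtain s where s: "robust_value N a b l < ereal s" "ereal s < robust_value N a b k"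
      using ereal_dense2[of "robust_value N a b l" "robust_value N a b k"] by (auto simp: not_le)
    have "ereal (-1) < ereal s"
      using le_less_trans[OF robust_value_ge s(1)] by (simp add: one_ereal_def)
    moreover have "ereal s < ereal 1"
      using less_le_trans[OF s(2) robust_value_le[of a k, OF assms]] by (simp add: one_ereal_def)
    ultimately obtain t where t: "0 \<le> t" "margin t = s"
      using margin_surj[of s] by auto
    have "ereal t < dea_ranking N a b k"
      using s(2) t by (simp add: dea_ranking_gt_iff)
    also note le
    finally have "ereal s < robust_value N a b l"
      using t by (simp add: dea_ranking_gt_iff)
    with s(1) show False by simp
  qed
qed

theorem proposition2:
  fixes N :: nat
    and a :: "nat \<Rightarrow> real ^ 'n"
    and b :: "nat \<Rightarrow> real ^ 'm"
  assumes "N \<ge> 1"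
    and "\<And>i. i \<in> {1..N} \<Longrightarrow> 0 \<le> a i"
    and "\<And>i. i \<in> {1..N} \<Longrightarrow> 0 \<le> b i"
  shows "\<forall>k\<in>{1..N}. \<forall>l\<in>{1..N}.
           robust_ranking N a b k \<le> robust_ranking N a b l \<longleftrightarrow>
           dea_ranking N a b k \<le> dea_ranking N a b l"
proof (intro ballI)
  fix k l assume "k \<in> {1..N}"
  then have "robust_value N a b k \<le> robust_value N a b l \<longleftrightarrow>
      dea_ranking N a b k \<le> dea_ranking N a b l"
    using assms by (intro robust_value_le_iff_dea_ranking_le)
  then show "robust_ranking N a b k \<le> robust_ranking N a b l \<longleftrightarrow>
      dea_ranking N a b k \<le> dea_ranking N a b l"
    by (simp add: robust_ranking_def ereal_add_le_add_iff flip: robust_value_def)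
qed

end
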